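(* Let $t$ be an indeterminate, and let $F_n^{(a)}(q)$ ($n\ge 0$) be the $q$-Fibonacci numbers with parameter $a$. For every integer $n\ge 0$, $$1+\sum_{k=1}^n q^{a+k-1} (tq^{a};q)_{k-1} \left( F^{(a)}_{k-1}(q) - t F^{(a)}_{k+1}(q)\right) =(tq^{a};q)_{n}\, F^{(a)}_{n+1}(q).$$
   Context: The $q$-Fibonacci numbers with parameter $a$ are defined by $F_0^{(a)}(q)=0$, $F_1^{(a)}(q)=1$, and $F_{n+2}^{(a)}(q) = F_{n+1}^{(a)}(q) + q^{a+n} F_n^{(a)}(q)$ for $n\ge 0$. The $q$-rising factorial is $(A;q)_0=1$ and $(A;q)_m=(1-A)(1-Aq)\cdots(1-Aq^{m-1})$ for $m\ge 1$. Here $q$ is a nonzero complex number (or an indeterminate), and $q^{a+m}$ means $q^a\cdot q^m$ for a fixed nonzero value $q^a$. Empty sums equal $0$. *)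

theory Defs
  imports Complex_Main "HOL-Computational_Algebra.Polynomial"
begin

text \<open>
  The parameter \<open>a\<close> enters only through the value \<open>q\<^sup>a\<close>, which is passed as the argument \<open>qa\<close>;
  the power \<open>q\<^bsup>a+m\<^esup>\<close> is therefore written \<open>qa * q ^ m\<close>.
\<close>

fun qfib :: "'a::comm_ring_1 \<Rightarrow> 'a \<Rightarrow> nat \<Rightarrow> 'a" where
  "qfib qa q 0 = 0"
| "qfib qa q (Suc 0) = 1"
| "qfib qa q (Suc (Suc n)) = qfib qa q (Suc n) + qa * q ^ n * qfib qa q n"

definition qrising :: "'a::comm_ring_1 \<Rightarrow> 'a \<Rightarrow> nat \<Rightarrow> 'a" where
  "qrising A q m = (\<Prod>i<m. 1 - A * q ^ i)"

end

theory Submission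
  imports Defs
begin

text \<open>The sum telescopes. With \<open>R n\<close> the rising factorial and \<open>F n\<close>
  the q-Fibonacci number, the recurrence for \<open>F (n+2)\<close> gives \<open>R (n+1) * F (n+2) -
  R n * F (n+1) = qa * q^n * R n * (F n - t * F (n+2))\<close>, which is the summand at
  \<open>k = n + 1\<close>. This holds in every commutative ring (\<open>qfib_rising_sum\<close>),
  so the indeterminate case is its instance in the polynomial ring.\<close>

lemma qrising_Suc: "qrising A q (Suc n) = qrising A q n * (1 - A * q ^ n)"
  by (simp add: qrising_def)

lemma qfib_rising_sum:
  fixes q qa t :: "'a::comm_ring_1"
  shows "1 + (\<Sum>k=1..n. qa * q ^ (k - 1) * qrising (t * qa) q (k - 1)
              * (qfib qa q (k - 1) - t * qfib qa q (k + 1)))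
         = qrising (t * qa) q n * qfib qa q (n + 1)"
proof (induction n)
  case 0
  show ?case by (simp add: qrising_def)
next
  case (Suc n)
  have "1 + (\<Sum>k=1..Suc n. qa * q ^ (k - 1) * qrising (t * qa) q (k - 1)
              * (qfib qa q (k - 1) - t * qfib qa q (k + 1)))
      = qrising (t * qa) q n * qfib qa q (n + 1)
        + qa * q ^ n * qrising (t * qa) q n * (qfib qa q n - t * qfib qa q (n + 2))"
    using Suc.IH by (simp add: add.assoc[symmetric])
  \<comment> \<open>Splitting off the last factor \<open>1 - t * qa * q ^ n\<close> and expanding
    \<open>qfib qa q (n + 2)\<close> once leaves a ring identity.\<close>
  also have "\<dots> = qrising (t * qa) q (Suc n) * qfib qa q (Suc n + 1)"
    by (simp add: qrising_Suc algebra_simps)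
  finally show ?case .
qed

text \<open>Embedding scalars as constant polynomials is a ring homomorphism, so it commutes with
  the recurrence.\<close>

lemma qfib_const_poly: "qfib [:qa:] [:q:] n = [:qfib qa q n:]"
  by (induction qa q n rule: qfib.induct) (simp_all add: poly_const_pow one_pCons)

theorem mainTheorem12:
  fixes q qa :: "'a::field" and t :: "'a poly" and n :: nat
  assumes "q \<noteq> 0" and "qa \<noteq> 0" and "t = [:0, 1:]"
  shows "1 + (\<Sum>k=1..n. [:qa * q ^ (k - 1):] * qrising (t * [:qa:]) [:q:] (k - 1)
              * ([:qfib qa q (k - 1):] - t * [:qfib qa q (k + 1):]))
         = qrising (t * [:qa:]) [:q:] n * [:qfib qa q (n + 1):]"
proof -
  \<comment> \<open>Merges the product of constants in the ring identity into the single constant of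
    the goal.\<close>
  have "[:qa:] * [:q:] ^ m = [:qa * q ^ m:]" for m
    by (simp add: poly_const_pow)
  then show ?thesis
    using qfib_rising_sum[of "[:qa:]" "[:q:]" t n]
    by (simp only: qfib_const_poly)
qed

end
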